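(* Let $X$ be a compact space, let $p\in C(X)[t]$ be admissible, and let $T\in \mathrm{End}(C(X))$. If $T$ may be extended to $C(X)_{p}$ via $\pi_{X}^{*}$, then $T$ may also be extended to $C(X_{p})$ via $\pi_{X}^{*}$.
   Context: All algebras are commutative, unital, complex algebras; $\mathrm{End}(A)$ is the set of unital algebra endomorphisms of $A$. A compact space means a compact Hausdorff space. $C(X)$ is the algebra of continuous complex-valued functions on $X$. Let $p\in C(X)[t]$ be monic of degree at least $2$. For $x \in X$ let $p^{(\widehat x)}\in\mathbb{C}[t]$ be the polynomial obtained by evaluating the coefficients of $p$ at $x$. Put $X_p=\{(x,\lambda)\in X\times\mathbb{C}: p^{(\widehat x)}(\lambda)=0\}$, a compact space, and let $\pi_X:X_p\to X$ and $\pi_p:X_p\to\mathbb{C}$ be the restrictions of the coordinate projections. Define $\pi_X^*:C(X)\to C(X_p)$ by $\pi_X^*(g)=g\circ\pi_X$; this is an injective unital homomorphism. The discriminant $D_p\in C(X)$ is $D_p(x)=\prod_{i<j}(\lambda_i-\lambda_j)^2$, where $p^{(\widehat x)}=(t-\lambda_1)\cdots(t-\lambda_n)$. The polynomial $p$ is called admissible if it is monic, of degree at least $2$, and the zero set $Z(D_p)$ of $D_p$ has empty interior in $X$. $C(X)_p$ denotes the subalgebra of $C(X_p)$ generated by $\{\pi_p\}\cup\pi_X^*(C(X))$, i.e. the set of all functions $\sum_{k=0}^m (q_k\circ\pi_X)\pi_p^k$ with $q_k\in C(X)$ (for admissible $p$, this is isomorphic to the Arens-Hoffman extension $C(X)[t]/pC(X)[t]$,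 and $C(X_p)$ is the Cole extension). If $B$ is $C(X)_p$ or $C(X_p)$, then $T\in\mathrm{End}(C(X))$ extends to $B$ via $\pi_X^*$ if there is $T'\in\mathrm{End}(B)$ with $T'\pi_X^*=\pi_X^*T$. *)

theory Defs
  imports
    "HOL-Algebra.UnivPoly"
    "HOL-Combinatorics.List_Permutation"
    "HOL-Computational_Algebra.Fundamental_Theorem_Algebra"
    "HOL-Analysis.Analysis"
begin

text \<open>
  Functions on \<open>A\<close> are represented by functions that are extensional on \<open>A\<close>, so that equality in
  the algebra is equality on \<open>A\<close>.
\<close>

definition fun_algebra :: "'a set \<Rightarrow> ('a \<Rightarrow> complex) set \<Rightarrow> (complex, 'a \<Rightarrow> complex) module" where
  "fun_algebra A F =
     \<lparr>carrier = F,
      monoid.mult = (\<lambda>f g. \<lambda>x\<in>A. f x * g x),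
      one = (\<lambda>x\<in>A. 1),
      zero = (\<lambda>x\<in>A. 0),
      add = (\<lambda>f g. \<lambda>x\<in>A. f x + g x),
      module.smult = (\<lambda>c f. \<lambda>x\<in>A. c * f x)\<rparr>"

definition cont_algebra :: "'a topology \<Rightarrow> (complex, 'a \<Rightarrow> complex) module" where
  "cont_algebra X =
     fun_algebra (topspace X)
       {f. continuous_map X euclidean f \<and> f \<in> extensional (topspace X)}"

definition algebra_End :: "(complex, 'b) module \<Rightarrow> ('b \<Rightarrow> 'b) set" where
  "algebra_End B =
     {T \<in> ring_hom B B. \<forall>c. \<forall>f\<in>carrier B. T (module.smult B c f) = module.smult B c (T f)}"

definition extends_via ::
  "(complex, 'b) module \<Rightarrow> (complex, 'c) module \<Rightarrow> ('b \<Rightarrow> 'c) \<Rightarrow> ('b \<Rightarrow> 'b) \<Rightarrow> bool" where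
  "extends_via A B \<theta> T \<longleftrightarrow>
     (\<exists>T'\<in>algebra_End B. \<forall>g\<in>carrier A. T' (\<theta> g) = \<theta> (T g))"


subsection \<open>Polynomials over the algebra of continuous functions\<close>

text \<open>
  A polynomial with coefficients in \<open>C(X)\<close> is an element of the polynomial ring
  \<open>UP (cont_algebra X)\<close>; evaluating its coefficients at a point gives a complex polynomial.
\<close>

definition eval_coeffs :: "'a topology \<Rightarrow> (nat \<Rightarrow> 'a \<Rightarrow> complex) \<Rightarrow> 'a \<Rightarrow> complex poly" where
  "eval_coeffs X p x =
     (\<Sum>i\<le>deg (cont_algebra X) p.
        Polynomial.monom (up_ring.coeff (UP (cont_algebra X)) p i x) i)"

definition root_space :: "'a topology \<Rightarrow> (nat \<Rightarrow> 'a \<Rightarrow> complex) \<Rightarrow> ('a \<times> complex) topology" where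
  "root_space X p =
     subtopology (prod_topology X euclidean)
       {(x, l). x \<in> topspace X \<and> poly (eval_coeffs X p x) l = 0}"

definition pullback ::
  "'a topology \<Rightarrow> (nat \<Rightarrow> 'a \<Rightarrow> complex) \<Rightarrow> ('a \<Rightarrow> complex) \<Rightarrow> ('a \<times> complex \<Rightarrow> complex)" where
  "pullback X p g = restrict (g \<circ> fst) (topspace (root_space X p))"

text \<open>
  The subalgebra of \<open>C(X\<^sub>p)\<close> generated by the pullbacks from \<open>C(X)\<close> and the second coordinate
  projection, given explicitly as the set of polynomial expressions in that projection.
\<close>

definition ext_algebra ::
  "'a topology \<Rightarrow> (nat \<Rightarrow> 'a \<Rightarrow> complex) \<Rightarrow> (complex, 'a \<times> complex \<Rightarrow> complex) module" where
  "ext_algebra X p =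
     fun_algebra (topspace (root_space X p))
       {(\<lambda>z\<in>topspace (root_space X p). \<Sum>k\<le>m. q k (fst z) * snd z ^ k) | (m::nat) q.
          \<forall>k\<le>m. q k \<in> carrier (cont_algebra X)}"


subsection \<open>Discriminant and admissibility\<close>

definition list_disc :: "complex list \<Rightarrow> complex" where
  "list_disc ls = (\<Prod>(i, j)\<in>{(i, j). i < j \<and> j < length ls}. (ls ! i - ls ! j)\<^sup>2)"

text \<open>
  The discriminant of a monic complex polynomial; by \<open>poly_disc_eq\<close> below it does not depend on
  the chosen enumeration of the roots.
\<close>

definition poly_disc :: "complex poly \<Rightarrow> complex" where
  "poly_disc q = list_disc (SOME ls. q = (\<Prod>l\<leftarrow>ls. [:- l, 1:]))"

lemma list_disc_perm:
  assumes "mset ls = mset ks"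
  shows "list_disc ls = list_disc ks"
proof -
  let ?n = "length ks"
  let ?P = "{(i, j). i < j \<and> j < ?n}"
  have len: "length ls = ?n"
    using assms by (rule mset_eq_length)
  obtain f where f: "bij_betw f {..<?n} {..<?n}" and nth: "\<And>i. i < ?n \<Longrightarrow> ls ! i = ks ! f i"
    using permutation_Ex_bij[OF assms] len by auto
  have inj: "\<And>i j. i < ?n \<Longrightarrow> j < ?n \<Longrightarrow> f i = f j \<longleftrightarrow> i = j"
    using f by (auto simp: bij_betw_def inj_on_def)
  have lt: "\<And>i. i < ?n \<Longrightarrow> f i < ?n"
    using f by (auto simp: bij_betw_def)
  define h where "h = (\<lambda>(i, j). (min (f i) (f j), max (f i) (f j)))"
  have fin: "finite ?P"
    by (rule finite_subset[of _ "{..<?n} \<times> {..<?n}"]) auto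
  have sub: "h ` ?P \<subseteq> ?P"
  proof clarify
    fix i j a b assume ij: "i < j" "j < ?n" and e: "(a, b) = h (i, j)"
    then have "f i \<noteq> f j" "f i < ?n" "f j < ?n"
      using inj lt by auto
    then show "a < b \<and> b < ?n" using e by (auto simp: h_def)
  qed
  have injh: "inj_on h ?P"
  proof (rule inj_onI, clarify)
    fix i j k l assume ij: "i < j" "j < ?n" and kl: "k < l" "l < ?n" and e: "h (i, j) = h (k, l)"
    then have "(f i = f k \<and> f j = f l) \<or> (f i = f l \<and> f j = f k)"
      by (auto simp: h_def min_def max_def split: if_splits)
    then have "(i = k \<and> j = l) \<or> (i = l \<and> j = k)"
      using inj ij kl by (meson order.strict_trans)
    then show "i = k \<and> j = l" using ij kl by auto
  qed
  have img: "h ` ?P = ?P"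
    using endo_inj_surj[OF fin sub injh] .
  have "list_disc ks = (\<Prod>(i, j)\<in>h ` ?P. (ks ! i - ks ! j)\<^sup>2)"
    unfolding img by (simp add: list_disc_def)
  also have "\<dots> = (\<Prod>z\<in>?P. case h z of (i, j) \<Rightarrow> (ks ! i - ks ! j)\<^sup>2)"
    by (subst prod.reindex[OF injh]) (simp add: o_def)
  also have "\<dots> = (\<Prod>(i, j)\<in>?P. (ls ! i - ls ! j)\<^sup>2)"
    by (rule prod.cong) (auto simp: h_def nth min_def max_def power2_commute)
  also have "\<dots> = list_disc ls"
    by (simp add: list_disc_def len)
  finally show ?thesis by simp
qed

lemma poly_disc_eq:
  assumes "q = (\<Prod>l\<leftarrow>ls. [:- l, 1:])"
  shows "poly_disc q = list_disc ls"
proof -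
  have roots: "proots (\<Prod>l\<leftarrow>ks. [:- l, 1:]) = mset ks" for ks :: "complex list"
  proof (induction ks)
    case (Cons k ks)
    have "(\<Prod>l\<leftarrow>ks. [:- l, 1:]) \<noteq> 0"
      by (auto simp: prod_list_zero_iff)
    then have "proots ([:- k, 1:] * (\<Prod>l\<leftarrow>ks. [:- l, 1:])) = {#k#} + mset ks"
      using Cons by (subst proots_mult) auto
    then show ?case by (simp del: mult_pCons_left)
  qed simp
  define ks where "ks = (SOME ks. q = (\<Prod>l\<leftarrow>ks. [:- l, 1:]))"
  have "q = (\<Prod>l\<leftarrow>ks. [:- l, 1:])"
    unfolding ks_def using assms by (rule someI)
  then have "mset ks = mset ls"
    using assms roots by metis
  then show ?thesis
    unfolding poly_disc_def ks_def[symmetric] by (rule list_disc_perm)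
qed

definition admissible :: "'a topology \<Rightarrow> (nat \<Rightarrow> 'a \<Rightarrow> complex) \<Rightarrow> bool" where
  "admissible X p \<longleftrightarrow>
     p \<in> carrier (UP (cont_algebra X)) \<and>
     up_ring.coeff (UP (cont_algebra X)) p (deg (cont_algebra X) p) = one (cont_algebra X) \<and>
     deg (cont_algebra X) p \<ge> 2 \<and>
     X interior_of {x \<in> topspace X. poly_disc (eval_coeffs X p x) = 0} = {}"

end

(* Composing an extension T' to C(X)_p with evaluation at a point z of X_p gives a character of
   C(X)_p. On C(X) it is evaluation at some x, and if l is its value at pi_p, then applying it to
   p(pi_p) = 0 gives p^(x)(l) = 0. So the character is evaluation at a point tau(z) = (x, l) of X_p.
   The map tau is continuous, and composition with tau is the required endomorphism of C(X_p). *)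

theory Submission
  imports Defs
begin

section \<open>Pointwise operations and membership in C(X)\<close>

lemma continuous_map_mult:
  fixes f g :: "'a \<Rightarrow> 'b::real_normed_algebra"
  assumes "continuous_map X euclidean f" "continuous_map X euclidean g"
  shows "continuous_map X euclidean (\<lambda>x. f x * g x)"
proof -
  have "continuous_map (prod_topology euclidean euclidean) euclidean (\<lambda>z::'b \<times> 'b. fst z * snd z)"
    by (simp flip: euclidean_product_topology) (intro continuous_intros)
  from continuous_map_compose[OF continuous_map_pairedI[OF assms] this]
  show ?thesis by (simp add: o_def)
qed

lemma continuous_map_power:
  fixes f :: "'a \<Rightarrow> 'b::real_normed_algebra_1"
  assumes "continuous_map X euclidean f"
  shows "continuous_map X euclidean (\<lambda>x. f x ^ n)"
  by (induction n) (simp_all add: continuous_map_mult assms)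

lemma fun_algebra_simps [simp]:
  "carrier (fun_algebra A F) = F"
  "f \<otimes>\<^bsub>fun_algebra A F\<^esub> g = (\<lambda>x\<in>A. f x * g x)"
  "\<one>\<^bsub>fun_algebra A F\<^esub> = (\<lambda>x\<in>A. 1)"
  "\<zero>\<^bsub>fun_algebra A F\<^esub> = (\<lambda>x\<in>A. 0)"
  "f \<oplus>\<^bsub>fun_algebra A F\<^esub> g = (\<lambda>x\<in>A. f x + g x)"
  "c \<odot>\<^bsub>fun_algebra A F\<^esub> f = (\<lambda>x\<in>A. c * f x)"
  by (simp_all add: fun_algebra_def)

lemma cont_algebra_simps [simp]:
  "f \<otimes>\<^bsub>cont_algebra X\<^esub> g = (\<lambda>x\<in>topspace X. f x * g x)"
  "\<one>\<^bsub>cont_algebra X\<^esub> = (\<lambda>x\<in>topspace X. 1)"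
  "f \<oplus>\<^bsub>cont_algebra X\<^esub> g = (\<lambda>x\<in>topspace X. f x + g x)"
  "c \<odot>\<^bsub>cont_algebra X\<^esub> f = (\<lambda>x\<in>topspace X. c * f x)"
  by (simp_all add: cont_algebra_def)

lemma restrict_in_cont_algebra:
  assumes "continuous_map X euclidean f"
  shows "restrict f (topspace X) \<in> carrier (cont_algebra X)"
  using continuous_map_eq[OF assms, of "restrict f (topspace X)"]
  by (simp add: cont_algebra_def)

lemma cont_algebraD:
  assumes "f \<in> carrier (cont_algebra X)"
  shows "continuous_map X euclidean f" "f \<in> extensional (topspace X)"
  using assms by (simp_all add: cont_algebra_def)

lemma const_in_cont_algebra: "(\<lambda>x\<in>topspace X. c) \<in> carrier (cont_algebra X)"
  by (rule restrict_in_cont_algebra) simp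

lemma cont_algebra_closed:
  assumes "f \<in> carrier (cont_algebra X)" "g \<in> carrier (cont_algebra X)"
  shows "f \<oplus>\<^bsub>cont_algebra X\<^esub> g \<in> carrier (cont_algebra X)"
    and "f \<otimes>\<^bsub>cont_algebra X\<^esub> g \<in> carrier (cont_algebra X)"
  unfolding cont_algebra_simps
  by (intro restrict_in_cont_algebra continuous_map_add continuous_map_mult assms[THEN cont_algebraD(1)])+

section \<open>Characters of C(X) for compact X\<close>

text \<open>The character is given by its laws on the carrier rather than as a bundled homomorphism,
  so that \<open>\<lambda>f. T f x\<close> for an endomorphism \<open>T\<close> is an instance
  directly.\<close>

lemma cont_algebra_character:
  fixes \<phi> :: "('a \<Rightarrow> complex) \<Rightarrow> complex"
  assumes X: "compact_space X"
    and add: "\<And>f g. f \<in> carrier (cont_algebra X) \<Longrightarrow> g \<in> carrier (cont_algebra X) \<Longrightarrow>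
      \<phi> (f \<oplus>\<^bsub>cont_algebra X\<^esub> g) = \<phi> f + \<phi> g"
    and mult: "\<And>f g. f \<in> carrier (cont_algebra X) \<Longrightarrow> g \<in> carrier (cont_algebra X) \<Longrightarrow>
      \<phi> (f \<otimes>\<^bsub>cont_algebra X\<^esub> g) = \<phi> f * \<phi> g"
    and smult: "\<And>c f. f \<in> carrier (cont_algebra X) \<Longrightarrow> \<phi> (c \<odot>\<^bsub>cont_algebra X\<^esub> f) = c * \<phi> f"
    and one: "\<phi> \<one>\<^bsub>cont_algebra X\<^esub> = 1"
  obtains x where "x \<in> topspace X" "\<And>f. f \<in> carrier (cont_algebra X) \<Longrightarrow> \<phi> f = f x"
proof (rule ccontr)
  let ?C = "carrier (cont_algebra X)"
  note c = restrict_in_cont_algebra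
  have const: "\<phi> (\<lambda>x\<in>topspace X. c) = c" for c
    using smult[OF const_in_cont_algebra[of 1 X], of c] one by (simp cong: restrict_cong)
  \<comment> \<open>Otherwise, by compactness, finitely many elements of the kernel have no common zero, and the
    sum of their squared absolute values is an invertible element of the kernel.\<close>
  note evaluation = that
  assume "\<not> thesis"
  then have "\<exists>f\<in>?C. \<phi> f \<noteq> f x" if "x \<in> topspace X" for x
    using evaluation[OF that] by blast
  then obtain f where f: "\<And>x. x \<in> topspace X \<Longrightarrow> f x \<in> ?C" "\<And>x. x \<in> topspace X \<Longrightarrow> \<phi> (f x) \<noteq> f x x"
    by metis
  \<comment> \<open>Subtracting the constant \<open>\<phi> (f x)\<close> moves \<open>f x\<close>
    into the kernel of \<open>\<phi>\<close>, and the value at \<open>x\<close> stays nonzero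
    because \<open>\<phi> (f x) \<noteq> f x x\<close>.\<close>
  define h where "h x = (\<lambda>y\<in>topspace X. f x y - \<phi> (f x))" for x
  have h: "h x \<in> ?C" "\<phi> (h x) = 0" "h x x \<noteq> 0" if x: "x \<in> topspace X" for x
  proof -
    show "h x \<in> ?C"
      unfolding h_def using cont_algebraD(1)[OF f(1)[OF x]] by (intro c continuous_intros) auto
    have "h x = f x \<oplus>\<^bsub>cont_algebra X\<^esub> (\<lambda>y\<in>topspace X. - \<phi> (f x))"
      by (auto simp: h_def)
    then show "\<phi> (h x) = 0"
      using add[OF f(1)[OF x] const_in_cont_algebra[of "- \<phi> (f x)" X]] const by simp
    show "h x x \<noteq> 0"
      using f(2)[OF x] x by (simp add: h_def)
  qed
  define U where "U x = {y \<in> topspace X. h x y \<in> - {0}}" for x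
  have opU: "openin X (U x)" if "x \<in> topspace X" for x
    unfolding U_def using cont_algebraD(1)[OF h(1)[OF that]]
    by (rule openin_continuous_map_preimage) auto
  have "topspace X \<subseteq> \<Union>(U ` topspace X)"
    using h(3) by (auto simp: U_def)
  moreover have "\<forall>V\<in>U ` topspace X. openin X V"
    using opU by auto
  ultimately obtain W where W: "finite W" "W \<subseteq> U ` topspace X" "topspace X \<subseteq> \<Union>W"
    using X unfolding compact_space_alt by metis
  then obtain F where F: "finite F" "F \<subseteq> topspace X" "W = U ` F"
    by (metis finite_subset_image)
  \<comment> \<open>Each squared modulus is written as a product with the conjugate, so that every
    summand is a multiple of the kernel element \<open>h x\<close>; induction on \<open>G\<close>
    then keeps the sum in the kernel.\<close>
  define s where "s G = (\<lambda>y\<in>topspace X. \<Sum>x\<in>G. h x y * cnj (h x y))" for G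
  have s: "s G \<in> ?C \<and> \<phi> (s G) = 0" if "finite G" "G \<subseteq> topspace X" for G
    using that
  proof (induction G)
    case empty
    then show ?case
      using const[of 0] const_in_cont_algebra[of 0 X] by (simp add: s_def del: restrict_apply)
  next
    case (insert x G)
    let ?k = "\<lambda>y\<in>topspace X. cnj (h x y)"
    have x: "x \<in> topspace X" using insert by auto
    have "continuous_map X euclidean (cnj \<circ> h x)"
      using cont_algebraD(1)[OF h(1)[OF x]]
      by (rule continuous_map_compose) (auto intro!: continuous_intros)
    then have k: "?k \<in> ?C"
      using c[of X "cnj \<circ> h x"] by (simp add: o_def)
    let ?m = "h x \<otimes>\<^bsub>cont_algebra X\<^esub> ?k"
    have m: "?m \<in> ?C" "\<phi> ?m = 0"
      using cont_algebra_closed(2)[OF h(1)[OF x] k] mult[OF h(1)[OF x] k] h(2)[OF x]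
      by (metis, metis mult_zero_left)
    have G: "s G \<in> ?C" "\<phi> (s G) = 0"
      using insert by auto
    have e: "s (insert x G) = ?m \<oplus>\<^bsub>cont_algebra X\<^esub> s G"
      using insert.hyps by (auto simp: s_def)
    show ?case
      unfolding e using cont_algebra_closed(1)[OF m(1) G(1)] add[OF m(1) G(1)] m(2) G(2)
      by (metis add_0)
  qed
  have nz: "s F y \<noteq> 0" if y: "y \<in> topspace X" for y
  proof -
    obtain x where x: "x \<in> F" "h x y \<noteq> 0"
      using W(3) F(3) y by (auto simp: U_def)
    have "s F y = of_real (\<Sum>x\<in>F. (cmod (h x y))\<^sup>2)"
      using y by (simp add: s_def flip: complex_norm_square)
    moreover have "(\<Sum>x\<in>F. (cmod (h x y))\<^sup>2) > 0"
      using F(1) x by (intro sum_pos2[of _ x]) auto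
    ultimately show ?thesis by (metis of_real_eq_0_iff less_irrefl)
  qed
  let ?r = "\<lambda>y\<in>topspace X. inverse (s F y)"
  have sF: "s F \<in> ?C" "\<phi> (s F) = 0" using s[OF F(1,2)] by auto
  \<comment> \<open>Having no zeros, \<open>s F\<close> factors through the punctured plane, where
    inversion is continuous; hence its pointwise inverse lies in C(X).\<close>
  have "continuous_map X (top_of_set (- {0})) (s F)"
    using cont_algebraD(1)[OF sF(1)] nz by (auto simp: continuous_map_in_subtopology)
  moreover have "continuous_map (top_of_set (- {0})) euclidean (inverse :: complex \<Rightarrow> complex)"
    by (auto intro!: continuous_intros)
  ultimately have "continuous_map X euclidean (inverse \<circ> s F)"
    by (rule continuous_map_compose)
  then have r: "?r \<in> ?C"
    using c[of X "inverse \<circ> s F"] by (simp add: o_def)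
  have "s F \<otimes>\<^bsub>cont_algebra X\<^esub> ?r = \<one>\<^bsub>cont_algebra X\<^esub>"
    using nz by (auto simp: fun_eq_iff restrict_def)
  then show False
    using mult[OF sF(1) r] sF(2) one by simp
qed

section \<open>Endomorphisms of C(X) as composition operators\<close>

text \<open>A completely regular topology is generated by its continuous functions: around each
  point of an open set \<open>U\<close> there is a set \<open>{g \<noteq> 1}\<close> inside
  \<open>U\<close>, and its preimage is open by \<open>cont\<close>.\<close>

lemma continuous_map_if_cont_algebra:
  assumes Y: "completely_regular_space Y"
    and \<sigma>: "\<sigma> \<in> topspace X \<rightarrow> topspace Y"
    and cont: "\<And>g. g \<in> carrier (cont_algebra Y) \<Longrightarrow> continuous_map X euclidean (\<lambda>x. g (\<sigma> x))"
  shows "continuous_map X Y \<sigma>"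
  unfolding continuous_map_def
proof (intro conjI allI impI \<sigma>)
  fix U assume U: "openin Y U"
  show "openin X {x \<in> topspace X. \<sigma> x \<in> U}"
  proof (subst openin_subopen, clarify)
    fix x assume x: "x \<in> topspace X" "\<sigma> x \<in> U"
    \<comment> \<open>The double complement matches the definition of complete regularity, which
      separates a closed set from a point outside it.\<close>
    have "closedin Y (topspace Y - U)" "\<sigma> x \<in> topspace Y - (topspace Y - U)"
      using U x \<sigma> by auto
    then obtain f :: "_ \<Rightarrow> real" where f: "continuous_map Y (top_of_set {0..1}) f" "f (\<sigma> x) = 0"
        "f ` (topspace Y - U) \<subseteq> {1}"
      using Y unfolding completely_regular_space_def by metis
    let ?g = "\<lambda>y\<in>topspace Y. complex_of_real (f y)"
    have "continuous_map Y euclidean (complex_of_real \<circ> f)"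
      using f(1) by (auto simp: continuous_map_in_subtopology intro!: continuous_map_compose continuous_intros)
    then have "?g \<in> carrier (cont_algebra Y)"
      using restrict_in_cont_algebra[of Y "complex_of_real \<circ> f"] by (simp add: o_def)
    from openin_continuous_map_preimage[OF cont[OF this], of "- {1}"]
    have "openin X {z \<in> topspace X. ?g (\<sigma> z) \<in> - {1}}" by (simp add: open_Compl)
    moreover have "x \<in> {z \<in> topspace X. ?g (\<sigma> z) \<in> - {1}}"
      using x f(2) \<sigma> by auto
    moreover have "{z \<in> topspace X. ?g (\<sigma> z) \<in> - {1}} \<subseteq> {x \<in> topspace X. \<sigma> x \<in> U}"
      using f(3) \<sigma> by auto
    ultimately show "\<exists>V. openin X V \<and> x \<in> V \<and> V \<subseteq> {x \<in> topspace X. \<sigma> x \<in> U}"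
      by blast
  qed
qed

lemma algebra_EndD:
  assumes "T \<in> algebra_End B"
  shows "f \<in> carrier B \<Longrightarrow> T f \<in> carrier B"
    and "f \<in> carrier B \<Longrightarrow> g \<in> carrier B \<Longrightarrow> T (f \<otimes>\<^bsub>B\<^esub> g) = T f \<otimes>\<^bsub>B\<^esub> T g"
    and "f \<in> carrier B \<Longrightarrow> g \<in> carrier B \<Longrightarrow> T (f \<oplus>\<^bsub>B\<^esub> g) = T f \<oplus>\<^bsub>B\<^esub> T g"
    and "T \<one>\<^bsub>B\<^esub> = \<one>\<^bsub>B\<^esub>"
    and "f \<in> carrier B \<Longrightarrow> T (c \<odot>\<^bsub>B\<^esub> f) = c \<odot>\<^bsub>B\<^esub> T f"
  using assms by (auto simp: algebra_End_def ring_hom_def)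

text \<open>For each \<open>x\<close>, following \<open>T\<close> by evaluation at \<open>x\<close>
  is a character of C(X), hence evaluation at some point, which is chosen as
  \<open>\<sigma> x\<close>.\<close>

lemma algebra_End_cont_algebra_compose:
  assumes X: "compact_space X" "Hausdorff_space X" and T: "T \<in> algebra_End (cont_algebra X)"
  obtains \<sigma> where "continuous_map X X \<sigma>"
    "\<And>f x. f \<in> carrier (cont_algebra X) \<Longrightarrow> x \<in> topspace X \<Longrightarrow> T f x = f (\<sigma> x)"
proof -
  note D = algebra_EndD[OF T]
  have "\<exists>y\<in>topspace X. \<forall>f\<in>carrier (cont_algebra X). T f x = f y" if x: "x \<in> topspace X" for x
  proof (rule cont_algebra_character[OF X(1), of "\<lambda>f. T f x"])
  qed (use D x in auto)
  then obtain \<sigma> where \<sigma>: "\<And>x. x \<in> topspace X \<Longrightarrow> \<sigma> x \<in> topspace X"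
    "\<And>f x. f \<in> carrier (cont_algebra X) \<Longrightarrow> x \<in> topspace X \<Longrightarrow> T f x = f (\<sigma> x)"
    by metis
  have "completely_regular_space X"
    using X by (simp add: normal_imp_completely_regular_space compact_Hausdorff_or_regular_imp_normal_space)
  then have "continuous_map X X \<sigma>"
  proof (rule continuous_map_if_cont_algebra)
    fix g assume g: "g \<in> carrier (cont_algebra X)"
    \<comment> \<open>On the space, \<open>g\<close> after \<open>\<sigma>\<close> coincides with
      \<open>T g\<close>, which is continuous as an element of C(X).\<close>
    show "continuous_map X euclidean (\<lambda>x. g (\<sigma> x))"
      using cont_algebraD(1)[OF D(1)[OF g]] by (rule continuous_map_eq) (simp add: \<sigma>(2)[OF g])
  qed (use \<sigma> in auto)
  then show thesis using that \<sigma>(2) by blast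
qed

lemma compose_in_algebra_End:
  assumes "continuous_map Y Y \<tau>"
  shows "(\<lambda>f. \<lambda>y\<in>topspace Y. f (\<tau> y)) \<in> algebra_End (cont_algebra Y)"
proof -
  have \<tau>: "\<tau> y \<in> topspace Y" if "y \<in> topspace Y" for y
    using assms that by (auto simp: continuous_map_def)
  have "(\<lambda>y\<in>topspace Y. f (\<tau> y)) \<in> carrier (cont_algebra Y)" if "f \<in> carrier (cont_algebra Y)" for f
    using continuous_map_compose[OF assms cont_algebraD(1)[OF that]]
    by (intro restrict_in_cont_algebra) (simp add: o_def)
  then show ?thesis
    using \<tau> by (auto simp: algebra_End_def ring_hom_def cong: restrict_cong)
qed

section \<open>The algebra C(X)_p on the root space\<close>

lemma ext_algebra_simps [simp]:
  "f \<otimes>\<^bsub>ext_algebra X p\<^esub> g = (\<lambda>z\<in>topspace (root_space X p). f z * g z)"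
  "\<one>\<^bsub>ext_algebra X p\<^esub> = (\<lambda>z\<in>topspace (root_space X p). 1)"
  "f \<oplus>\<^bsub>ext_algebra X p\<^esub> g = (\<lambda>z\<in>topspace (root_space X p). f z + g z)"
  by (simp_all add: ext_algebra_def)

lemma ext_algebra_memI:
  assumes "\<And>k. k \<le> m \<Longrightarrow> q k \<in> carrier (cont_algebra X)"
  shows "(\<lambda>z\<in>topspace (root_space X p). \<Sum>k\<le>m. q k (fst z) * snd z ^ k) \<in> carrier (ext_algebra X p)"
  using assms by (auto simp: ext_algebra_def)

lemma topspace_root_space:
  "topspace (root_space X p) = {(x, l). x \<in> topspace X \<and> poly (eval_coeffs X p x) l = 0}"
  by (auto simp: root_space_def)

lemma continuous_map_root_space:
  "continuous_map (root_space X p) X fst" "continuous_map (root_space X p) euclidean snd"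
  unfolding root_space_def
  by (auto intro!: continuous_map_from_subtopology continuous_map_fst continuous_map_snd)

text \<open>Needed for the image of pi_p under an endomorphism of C(X)_p: that image becomes the
  second component of \<open>\<tau>\<close>.\<close>

lemma ext_algebra_continuous:
  assumes "f \<in> carrier (ext_algebra X p)"
  shows "continuous_map (root_space X p) euclidean f"
proof -
  obtain m q where q: "\<And>k. k \<le> m \<Longrightarrow> q k \<in> carrier (cont_algebra X)"
    and f: "f = (\<lambda>z\<in>topspace (root_space X p). \<Sum>k\<le>m. q k (fst z) * snd z ^ k)"
    using assms by (auto simp: ext_algebra_def)
  have "continuous_map (root_space X p) euclidean (\<lambda>z. q k (fst z))" if "k \<le> m" for k
    using continuous_map_compose[OF continuous_map_root_space(1) cont_algebraD(1)[OF q[OF that]]]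
    by (simp add: o_def)
  then have "continuous_map (root_space X p) euclidean (\<lambda>z. \<Sum>k\<le>m. q k (fst z) * snd z ^ k)"
    by (intro continuous_map_sum continuous_map_mult continuous_map_power continuous_map_root_space) auto
  then show ?thesis
    unfolding f by (rule continuous_map_eq) simp
qed

lemma pullback_in_ext_algebra:
  assumes "g \<in> carrier (cont_algebra X)"
  shows "pullback X p g \<in> carrier (ext_algebra X p)"
  using ext_algebra_memI[of 0 "\<lambda>_. g" X p] assms by (simp add: pullback_def o_def)

lemma snd_power_in_ext_algebra:
  "(\<lambda>z\<in>topspace (root_space X p). snd z ^ k) \<in> carrier (ext_algebra X p)"
proof -
  \<comment> \<open>The power is brought into the defining form of \<open>ext_algebra\<close> with
    constant coefficients: 1 at \<open>j = k\<close> and 0 below.\<close>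
  have "(\<Sum>j\<le>k. (\<lambda>x\<in>topspace X. if j = k then 1 else 0) (fst z) * snd z ^ j) = snd z ^ k"
    if "z \<in> topspace (root_space X p)" for z :: "'a \<times> complex"
    using that by (auto simp: topspace_root_space if_distrib[of "\<lambda>a. a * _"] cong: if_cong)
  with ext_algebra_memI[of k "\<lambda>j. \<lambda>x\<in>topspace X. if j = k then 1 else 0" X p]
  show ?thesis
    by (simp add: const_in_cont_algebra cong: restrict_cong)
qed

text \<open>A homomorphism commutes with polynomial expressions, so \<open>S\<close> is determined
  by \<open>T\<close> on the coefficients and by its value on pi_p. Applied to \<open>p\<close>
  itself, this shows that the value of \<open>S\<close> on pi_p at \<open>z\<close> is a root of a
  fibre polynomial.\<close>

lemma extension_polynomial:
  assumes S: "S \<in> algebra_End (ext_algebra X p)"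
    and ext: "\<And>g. g \<in> carrier (cont_algebra X) \<Longrightarrow> S (pullback X p g) = pullback X p (T g)"
    and q: "\<And>k. k \<le> m \<Longrightarrow> q k \<in> carrier (cont_algebra X)"
    and z: "z \<in> topspace (root_space X p)"
  shows "S (\<lambda>z\<in>topspace (root_space X p). \<Sum>k\<le>m. q k (fst z) * snd z ^ k) z =
    (\<Sum>k\<le>m. T (q k) (fst z) * S (restrict snd (topspace (root_space X p))) z ^ k)"
proof -
  let ?K = "topspace (root_space X p)"
  note D = algebra_EndD[OF S]
  have pb: "S (pullback X p g) z = T g (fst z)" if "g \<in> carrier (cont_algebra X)" for g
    using ext[OF that] z by (simp add: pullback_def)
  show ?thesis
    using q
  proof (induction m)
    case 0
    have "(\<lambda>z\<in>?K. \<Sum>k\<le>0. q k (fst z) * snd z ^ k) = pullback X p (q 0)"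
      by (simp add: pullback_def o_def)
    then show ?case using pb[of "q 0"] 0 by simp
  next
    case (Suc m)
    let ?P = "\<lambda>z\<in>?K. \<Sum>k\<le>m. q k (fst z) * snd z ^ k"
    let ?g = "pullback X p (q (Suc m))"
    let ?M = "\<lambda>k. \<lambda>z\<in>?K. snd z ^ k"
    \<comment> \<open>The power 0 is the unit of the algebra, preserved by \<open>S\<close>; higher
      powers follow by multiplicativity, with \<open>?M 1\<close> being pi_p.\<close>
    have pow: "S (?M k) z = S (restrict snd ?K) z ^ k" for k
    proof (induction k)
      case 0
      then show ?case
        using fun_cong[OF D(4), of z] z by (simp add: restrict_apply' del: restrict_apply)
    next
      case (Suc k)
      have "?M (Suc k) = ?M 1 \<otimes>\<^bsub>ext_algebra X p\<^esub> ?M k"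
        by auto
      then have "S (?M (Suc k)) = S (?M 1) \<otimes>\<^bsub>ext_algebra X p\<^esub> S (?M k)"
        using D(2)[OF snd_power_in_ext_algebra[of 1 X p] snd_power_in_ext_algebra[of k X p]]
        by (simp only:)
      moreover have "?M 1 = restrict snd ?K"
        by auto
      ultimately show ?case
        using z Suc by (simp only: ext_algebra_simps restrict_apply' power_Suc)
    qed
    have mem: "?P \<in> carrier (ext_algebra X p)" "?g \<in> carrier (ext_algebra X p)"
      using Suc.prems by (auto intro!: ext_algebra_memI pullback_in_ext_algebra)
    have g: "q (Suc m) \<in> carrier (cont_algebra X)" using Suc.prems by simp
    \<comment> \<open>Additivity of \<open>S\<close> requires the top term to lie in the algebra; it
      is exhibited as an expression of degree \<open>Suc m\<close> whose lower coefficients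
      vanish.\<close>
    have prod: "?g \<otimes>\<^bsub>ext_algebra X p\<^esub> ?M (Suc m) \<in> carrier (ext_algebra X p)"
    proof -
      let ?q = "\<lambda>k. if k = Suc m then q (Suc m) else (\<lambda>x\<in>topspace X. 0)"
      have "?g \<otimes>\<^bsub>ext_algebra X p\<^esub> ?M (Suc m) = (\<lambda>z\<in>?K. \<Sum>k\<le>Suc m. ?q k (fst z) * snd z ^ k)"
        by (auto simp: pullback_def topspace_root_space fun_eq_iff)
      moreover have "\<dots> \<in> carrier (ext_algebra X p)"
        by (rule ext_algebra_memI) (auto simp: g const_in_cont_algebra simp del: restrict_apply)
      ultimately show ?thesis by simp
    qed
    have "(\<lambda>z\<in>?K. \<Sum>k\<le>Suc m. q k (fst z) * snd z ^ k) =
        ?P \<oplus>\<^bsub>ext_algebra X p\<^esub> (?g \<otimes>\<^bsub>ext_algebra X p\<^esub> ?M (Suc m))"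
      by (auto simp: pullback_def)
    then have "S (\<lambda>z\<in>?K. \<Sum>k\<le>Suc m. q k (fst z) * snd z ^ k) z =
        S ?P z + S ?g z * S (?M (Suc m)) z"
      using D(3)[OF mem(1) prod] D(2)[OF mem(2) snd_power_in_ext_algebra[of "Suc m" X p]] z
      by (simp only: ext_algebra_simps restrict_apply')
    then show ?case
      unfolding pow[of "Suc m"] pb[OF g] sum.atMost_Suc
      using Suc.IH[OF Suc.prems[OF le_SucI]] by metis
  qed
qed

section \<open>Extension to C(X_p)\<close>

theorem corollary3:
  fixes X :: "'a topology"
    and p :: "nat \<Rightarrow> 'a \<Rightarrow> complex"
    and T :: "('a \<Rightarrow> complex) \<Rightarrow> ('a \<Rightarrow> complex)"
  assumes "compact_space X"
    and "Hausdorff_space X"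
    and "admissible X p"
    and "T \<in> algebra_End (cont_algebra X)"
    and "extends_via (cont_algebra X) (ext_algebra X p) (pullback X p) T"
  shows "extends_via (cont_algebra X) (cont_algebra (root_space X p)) (pullback X p) T"
proof -
  let ?K = "topspace (root_space X p)"
  let ?d = "deg (cont_algebra X) p"
  define c where "c = up_ring.coeff (UP (cont_algebra X)) p"
  obtain S where S: "S \<in> algebra_End (ext_algebra X p)"
    and ext: "\<And>g. g \<in> carrier (cont_algebra X) \<Longrightarrow> S (pullback X p g) = pullback X p (T g)"
    using assms(5) by (auto simp: extends_via_def)
  obtain \<sigma> where \<sigma>: "continuous_map X X \<sigma>"
    "\<And>f x. f \<in> carrier (cont_algebra X) \<Longrightarrow> x \<in> topspace X \<Longrightarrow> T f x = f (\<sigma> x)"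
    using algebra_End_cont_algebra_compose[OF assms(1,2,4)] by blast
  have \<sigma>_in: "\<sigma> x \<in> topspace X" if "x \<in> topspace X" for x
    using \<sigma>(1) that by (auto simp: continuous_map_def)
  have c: "c k \<in> carrier (cont_algebra X)" for k
    using assms(3) by (auto simp: c_def admissible_def UP_def)
  have poly: "poly (eval_coeffs X p x) l = (\<Sum>k\<le>?d. c k x * l ^ k)" for x l
    by (simp add: eval_coeffs_def c_def poly_sum poly_monom)
  define e where "e = S (restrict snd ?K)"
  \<comment> \<open>The base coordinate comes from \<open>T\<close> alone; the fibre coordinate is
    the value at \<open>z\<close> of the image of pi_p under \<open>S\<close>.\<close>
  define \<tau> where "\<tau> z = (\<sigma> (fst z), e z)" for z
  have "restrict snd ?K \<in> carrier (ext_algebra X p)"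
    using snd_power_in_ext_algebra[of 1 X p] by (simp cong: restrict_cong)
  then have e: "continuous_map (root_space X p) euclidean e"
    unfolding e_def by (intro ext_algebra_continuous algebra_EndD(1)[OF S])
  have \<tau>_in: "\<tau> z \<in> ?K" if z: "z \<in> ?K" for z
  proof -
    let ?zero = "\<lambda>x\<in>topspace X. 0"
    have x: "fst z \<in> topspace X" using z by (auto simp: topspace_root_space)
    have "(\<Sum>k\<le>?d. c k (\<sigma> (fst z)) * e z ^ k) = (\<Sum>k\<le>?d. T (c k) (fst z) * e z ^ k)"
      using \<sigma>(2)[OF c x] by simp
    also have "\<dots> = S (\<lambda>z\<in>?K. \<Sum>k\<le>?d. c k (fst z) * snd z ^ k) z"
      using extension_polynomial[where q = c and m = ?d, OF S ext c z] by (simp only: e_def)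
    \<comment> \<open>Every point of X_p is a root, so \<open>p\<close> evaluated at pi_p is the
      zero function. Viewing it as the pullback of 0 lets \<open>ext\<close> apply, and
      \<open>T\<close> maps 0 to 0 since it composes with \<open>\<sigma>\<close>.\<close>
    also have "(\<lambda>z\<in>?K. \<Sum>k\<le>?d. c k (fst z) * snd z ^ k) = pullback X p ?zero"
      by (auto simp: pullback_def topspace_root_space poly fun_eq_iff)
    also have "S \<dots> z = 0"
      using ext[OF const_in_cont_algebra[of 0 X]] \<sigma>(2)[OF const_in_cont_algebra[of 0 X] x]
        \<sigma>_in[OF x] z by (simp add: pullback_def)
    finally show ?thesis
      using \<sigma>_in[OF x] by (simp add: \<tau>_def topspace_root_space poly)
  qed
  have "continuous_map (root_space X p) (prod_topology X euclidean) \<tau>"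
    unfolding \<tau>_def
    using continuous_map_compose[OF continuous_map_root_space(1) \<sigma>(1)] e
    by (intro continuous_map_pairedI) (auto simp: o_def)
  \<comment> \<open>X_p carries the subspace topology, so continuity into the product together with
    \<open>\<tau>_in\<close> suffices; only the target copy of \<open>root_space\<close> is
    unfolded.\<close>
  then have "continuous_map (root_space X p) (root_space X p) \<tau>"
    using \<tau>_in unfolding topspace_root_space
    by (subst (2) root_space_def) (auto simp: continuous_map_in_subtopology topspace_root_space)
  then have "(\<lambda>f. \<lambda>z\<in>?K. f (\<tau> z)) \<in> algebra_End (cont_algebra (root_space X p))"
    by (rule compose_in_algebra_End)
  \<comment> \<open>On X_p both sides equal \<open>g (\<sigma> (fst z))\<close>, because the first
    coordinate of \<open>\<tau> z\<close> is \<open>\<sigma> (fst z)\<close>; off X_p both are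
    \<open>undefined\<close>.\<close>
  moreover have "(\<lambda>z\<in>?K. pullback X p g (\<tau> z)) = pullback X p (T g)"
    if "g \<in> carrier (cont_algebra X)" for g
  proof
    fix z
    show "(\<lambda>z\<in>?K. pullback X p g (\<tau> z)) z = pullback X p (T g) z"
      using \<tau>_in[of z] \<sigma>(2)[OF that, of "fst z"]
      by (cases "z \<in> ?K") (auto simp: pullback_def \<tau>_def topspace_root_space)
  qed
  ultimately show ?thesis
    unfolding extends_via_def by (intro bexI[of _ "\<lambda>f. \<lambda>z\<in>?K. f (\<tau> z)"] ballI)
qed

end
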